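(* Assume $n=2t$ is even and let $\mathbb{L}'$ be the subfield with $\mathbb{K}\le\mathbb{L}'<\mathbb{L}$ and $[\mathbb{L}:\mathbb{L}']=2$. Let $f$ be a monic irreducible element of $R$ with $f\notin Z(R)$, whose bound is $F(x^n)$ with $F(y)\in\mathbb{K}[y]$ monic irreducible of degree $s$, $F(y)\ne y$, and $\deg f=s\ell$ with $\ell=\ell_F$. Let $\gamma\in\mathbb{L}$ with $\gamma/f_0\in\mathbb{L}\setminus\mathbb{L}'$ and $\mathrm{N}_{\mathbb{L}/\mathbb{K}}(\gamma)$ not a square in $\mathbb{K}$ ($f_0$ the constant coefficient of $f$), and let $\mathbb{A}=(R/Rf,\star_D)$ with $$a\star_D b:=\Big(a-\frac{\gamma}{f_0}a_0''f\Big)b\bmod_r f,\qquad a=(a_0'+\gamma a_0'')+\sum_{i=1}^{s\ell-1}a_ix^i,\ a_0',a_0''\in\mathbb{L}',\ a_i\in\mathbb{L}.$$ Then $$\mathbb{N}_l(\mathbb{A})\cong\mathbb{L}',\quad\mathbb{N}_m(\mathbb{A})\cong\mathbb{L}',\quad\mathbb{N}_r(\mathbb{A})\cong\mathcal{E}(f),\quad Z(\mathbb{A})\cong\mathbb{K}.$$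
   Context: $\mathbb{K}$ is a field, $\mathbb{L}/\mathbb{K}$ cyclic Galois of degree $n$, $\sigma$ a generator of $\mathrm{Gal}(\mathbb{L}/\mathbb{K})$, $R=\mathbb{L}[x;\sigma]$ with $xa=\sigma(a)x$, $Z(R)=\mathbb{K}[x^n]$. The bound of $f$ is the monic central polynomial generating the largest two-sided ideal in $Rf$; $\ell_F=n/m$, $m$ the number of irreducible factors of $F(x^n)$ in $R$. $R/Rf$ is identified with polynomials of degree $<\deg f$, each uniquely written as $a$ above; $\mathbb{A}$ is a unital division algebra over $\mathbb{K}$ with unity $1$. $\mathcal{E}(f)=\{g\in R:\deg g<\deg f,\ fg\in Rf\}$ (multiplication mod $Rf$) is the eigenring. Nuclei: $\mathbb{N}_l=\{a:a\star(b\star c)=(a\star b)\star c\ \forall b,c\}$, $\mathbb{N}_m=\{b:\dots\ \forall a,c\}$, $\mathbb{N}_r=\{c:\dots\ \forall a,b\}$; the centre $Z(\mathbb{A})$ consists of the elements of $\mathbb{N}_l\cap\mathbb{N}_m\cap\mathbb{N}_r$ commuting with every element.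
   Formalization: The condition deg f = sℓ ≥ 2 is added: for deg f = 1 the claim N_r(A) ≅ E(f) always fails, e.g. K = Q, L = Q(i), f = x+1, γ = 1+i gives A = Q(√2), so all nuclei have dimension 2 over K while L' = E(f) = K. *)

theory Defs
  imports "HOL-Algebra.Algebraic_Closure_Type" "HOL-Algebra.Embedded_Algebras"
begin

text \<open>
  The field \<open>L\<close> is a type \<open>'l :: field\<close>; its subfields \<open>K\<close> and \<open>L'\<close> are subsets of that type.
\<close>

abbreviation fieldL :: "'l::field ring" where
  "fieldL \<equiv> ring_of_type_algebra"

definition Gal :: "'l::field set \<Rightarrow> ('l \<Rightarrow> 'l) set" where
  "Gal K = {\<tau> \<in> ring_iso fieldL fieldL. \<forall>k\<in>K. \<tau> k = k}"

text \<open>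
  The finiteness of \<open>Gal K\<close>, and with it the fact that non-negative powers of \<open>\<sigma>\<close> suffice to
  generate it, comes from the finite degree \<open>n\<close>.
\<close>

definition cyclic_galois :: "'l::field set \<Rightarrow> nat \<Rightarrow> ('l \<Rightarrow> 'l) \<Rightarrow> bool" where
  "cyclic_galois K n \<sigma> \<longleftrightarrow>
     subfield K fieldL \<and>
     ring.dimension fieldL n K UNIV \<and>
     {a. \<forall>\<tau>\<in>Gal K. \<tau> a = a} = K \<and>
     \<sigma> \<in> Gal K \<and> Gal K = {\<sigma> ^^ i | i. True}"

definition galois_norm :: "'l::field set \<Rightarrow> 'l \<Rightarrow> 'l" where
  "galois_norm K a = (\<Prod>\<tau>\<in>Gal K. \<tau> a)"

definition poly_ring_over :: "'l::field set \<Rightarrow> 'l poly ring" where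
  "poly_ring_over K = \<lparr>carrier = {p. set (coeffs p) \<subseteq> K}, monoid.mult = (*), one = 1,
     ring.zero = 0, add = (+)\<rparr>"

text \<open>
  Skew polynomials have the same underlying additive group as \<open>'l poly\<close>, with coefficients on the
  left; only the product differs: \<open>(a x^i) (b x^j) = a \<sigma>^i(b) x^(i+j)\<close>.
\<close>

definition skew_mult :: "('l::field \<Rightarrow> 'l) \<Rightarrow> 'l poly \<Rightarrow> 'l poly \<Rightarrow> 'l poly" where
  "skew_mult \<sigma> p q =
     (\<Sum>i\<le>Polynomial.degree p. \<Sum>j\<le>Polynomial.degree q.
        Polynomial.monom (Polynomial.coeff p i * (\<sigma> ^^ i) (Polynomial.coeff q j)) (i + j))"

definition skew_ring :: "('l::field \<Rightarrow> 'l) \<Rightarrow> 'l poly ring" where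
  "skew_ring \<sigma> = \<lparr>carrier = UNIV, monoid.mult = skew_mult \<sigma>, one = 1,
     ring.zero = 0, add = (+)\<rparr>"

definition ring_centre :: "('a, 'b) ring_scheme \<Rightarrow> 'a set" where
  "ring_centre R = {z \<in> carrier R. \<forall>y\<in>carrier R. z \<otimes>\<^bsub>R\<^esub> y = y \<otimes>\<^bsub>R\<^esub> z}"

text \<open>
  HOL-Algebra's \<open>irreducible\<close> is phrased through left divisibility; the following is the usual
  definition, valid without commutativity.
\<close>

definition irreducible_in :: "('a, 'b) ring_scheme \<Rightarrow> 'a \<Rightarrow> bool" where
  "irreducible_in R p \<longleftrightarrow> p \<in> carrier R \<and> p \<noteq> \<zero>\<^bsub>R\<^esub> \<and> p \<notin> Units R \<and>
     (\<forall>g\<in>carrier R. \<forall>h\<in>carrier R. p = g \<otimes>\<^bsub>R\<^esub> h \<longrightarrow> g \<in> Units R \<or> h \<in> Units R)"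

definition num_irreducible_factors :: "('a, 'b) ring_scheme \<Rightarrow> 'a \<Rightarrow> nat \<Rightarrow> bool" where
  "num_irreducible_factors R p m \<longleftrightarrow>
     (\<exists>ps. length ps = m \<and> (\<forall>q\<in>set ps. irreducible_in R q) \<and> p = foldr (monoid.mult R) ps \<one>\<^bsub>R\<^esub>)"

text \<open>
  Substitution of \<open>x^n\<close> may use commutative composition: only powers of \<open>x\<close> are multiplied.
\<close>

definition subst_power :: "nat \<Rightarrow> 'l::field poly \<Rightarrow> 'l poly" where
  "subst_power n F = pcompose F (Polynomial.monom 1 n)"

definition left_mults :: "('l::field \<Rightarrow> 'l) \<Rightarrow> 'l poly \<Rightarrow> 'l poly set" where
  "left_mults \<sigma> f = {skew_mult \<sigma> q f | q. True}"

definition is_bound :: "('l::field \<Rightarrow> 'l) \<Rightarrow> 'l poly \<Rightarrow> 'l poly \<Rightarrow> bool" where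
  "is_bound \<sigma> f h \<longleftrightarrow>
     lead_coeff h = 1 \<and> h \<in> ring_centre (skew_ring \<sigma>) \<and>
     genideal (skew_ring \<sigma>) {h} \<subseteq> left_mults \<sigma> f \<and>
     (\<forall>I. ideal I (skew_ring \<sigma>) \<and> I \<subseteq> left_mults \<sigma> f \<longrightarrow> I \<subseteq> genideal (skew_ring \<sigma>) {h})"

text \<open>Remainder of the right division \<open>a = q f + r\<close>.\<close>

definition rmod :: "('l::field \<Rightarrow> 'l) \<Rightarrow> 'l poly \<Rightarrow> 'l poly \<Rightarrow> 'l poly" where
  "rmod \<sigma> a f =
     (THE r. Polynomial.degree r < Polynomial.degree f \<and> (\<exists>q. a = skew_mult \<sigma> q f + r))"

text \<open>
  For \<open>\<gamma> \<notin> L'\<close> and \<open>[L : L'] = 2\<close>, \<open>snd_part L' \<gamma> c\<close> is the \<open>c''\<close> in the unique decomposition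
  \<open>c = c' + \<gamma> c''\<close> with \<open>c', c'' \<in> L'\<close>.
\<close>

definition snd_part :: "'l::field set \<Rightarrow> 'l \<Rightarrow> 'l \<Rightarrow> 'l" where
  "snd_part L' \<gamma> c = (THE c''. c'' \<in> L' \<and> (\<exists>c'\<in>L'. c = c' + \<gamma> * c''))"

definition star_D ::
  "('l::field \<Rightarrow> 'l) \<Rightarrow> 'l set \<Rightarrow> 'l \<Rightarrow> 'l poly \<Rightarrow> 'l poly \<Rightarrow> 'l poly \<Rightarrow> 'l poly" where
  "star_D \<sigma> L' \<gamma> f a b =
     rmod \<sigma> (skew_mult \<sigma>
       (a - Polynomial.smult
              (\<gamma> / Polynomial.coeff f 0 * snd_part L' \<gamma> (Polynomial.coeff a 0)) f) b) f"

text \<open>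
  Algebras over \<open>K\<close> are records of type \<open>module\<close>, used here as plain carriers of the operations:
  the product need not be associative, and only the scalars from \<open>K\<close> matter.
\<close>

definition algebra_D ::
  "('l::field \<Rightarrow> 'l) \<Rightarrow> 'l set \<Rightarrow> 'l \<Rightarrow> 'l poly \<Rightarrow> ('l, 'l poly) module" where
  "algebra_D \<sigma> L' \<gamma> f = \<lparr>carrier = {a. Polynomial.degree a < Polynomial.degree f},
     monoid.mult = star_D \<sigma> L' \<gamma> f, one = 1, ring.zero = 0, add = (+),
     module.smult = Polynomial.smult\<rparr>"

definition eigenring :: "('l::field \<Rightarrow> 'l) \<Rightarrow> 'l poly \<Rightarrow> ('l, 'l poly) module" where
  "eigenring \<sigma> f = \<lparr>carrier = {g. Polynomial.degree g < Polynomial.degree f \<and>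
       skew_mult \<sigma> f g \<in> left_mults \<sigma> f},
     monoid.mult = (\<lambda>g h. rmod \<sigma> (skew_mult \<sigma> g h) f), one = 1, ring.zero = 0, add = (+),
     module.smult = Polynomial.smult\<rparr>"

definition subfield_algebra :: "'l::field set \<Rightarrow> ('l, 'l) module" where
  "subfield_algebra M = \<lparr>carrier = M, monoid.mult = (*), one = 1, ring.zero = 0, add = (+),
     module.smult = (*)\<rparr>"

definition left_nucleus :: "('l, 'a) module \<Rightarrow> 'a set" where
  "left_nucleus A = {a \<in> carrier A. \<forall>b\<in>carrier A. \<forall>c\<in>carrier A.
     a \<otimes>\<^bsub>A\<^esub> (b \<otimes>\<^bsub>A\<^esub> c) = (a \<otimes>\<^bsub>A\<^esub> b) \<otimes>\<^bsub>A\<^esub> c}"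

definition middle_nucleus :: "('l, 'a) module \<Rightarrow> 'a set" where
  "middle_nucleus A = {b \<in> carrier A. \<forall>a\<in>carrier A. \<forall>c\<in>carrier A.
     a \<otimes>\<^bsub>A\<^esub> (b \<otimes>\<^bsub>A\<^esub> c) = (a \<otimes>\<^bsub>A\<^esub> b) \<otimes>\<^bsub>A\<^esub> c}"

definition right_nucleus :: "('l, 'a) module \<Rightarrow> 'a set" where
  "right_nucleus A = {c \<in> carrier A. \<forall>a\<in>carrier A. \<forall>b\<in>carrier A.
     a \<otimes>\<^bsub>A\<^esub> (b \<otimes>\<^bsub>A\<^esub> c) = (a \<otimes>\<^bsub>A\<^esub> b) \<otimes>\<^bsub>A\<^esub> c}"

definition nonassoc_centre :: "('l, 'a) module \<Rightarrow> 'a set" where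
  "nonassoc_centre A =
     {z \<in> left_nucleus A \<inter> middle_nucleus A \<inter> right_nucleus A.
        \<forall>y\<in>carrier A. z \<otimes>\<^bsub>A\<^esub> y = y \<otimes>\<^bsub>A\<^esub> z}"

text \<open>Isomorphism of \<open>K\<close>-algebras: a \<open>K\<close>-linear unital ring isomorphism.\<close>

definition alg_iso :: "'l set \<Rightarrow> ('l, 'a) module \<Rightarrow> ('l, 'b) module \<Rightarrow> bool" where
  "alg_iso K A B \<longleftrightarrow>
     (\<exists>\<phi> \<in> ring_iso A B. \<forall>k\<in>K. \<forall>a\<in>carrier A. \<phi> (k \<odot>\<^bsub>A\<^esub> a) = k \<odot>\<^bsub>B\<^esub> \<phi> a)"

end

(*
Write v_a for the left factor a - (gamma/f_0) a_0'' f in the definition of the product. These factors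
are exactly the polynomials of degree at most d = deg f with constant coefficient in L' and leading
(degree d) coefficient in (gamma/f_0) L', and reduction modulo Rf is inverse to a |-> v_a. So
(a,b,c) associates for all c iff v_a v_b - v_{a*b} annihilates R/Rf. The annihilator lies in
R F(x^n), and since f is not central, deg F(x^n) >= 2d. Taking x and gamma for the other factor, the
difference has degree below 2d, hence vanishes; comparing degrees then leaves only constants in L' in
the left and middle nuclei. The right nucleus is tested on x * x^(d-1), where v_{x*x^(d-1)} and x^d
differ by a unit multiple of f.

The norm hypothesis serves to show that gamma is not in L': the involution of the Galois group fixing
L' is the middle power of sigma, so norms of elements of L' are squares in K.
*)
theory Submission
  imports Defs
begin

section \<open>Skew polynomials\<close>

text \<open>Bijectivity of \<sigma> is not part of the setting: a unital endomorphism of a field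
  kills only 0, and this makes degrees additive.\<close>

locale skew_poly =
  fixes \<sigma> :: "'l::field \<Rightarrow> 'l"
  assumes \<sigma>_add: "\<sigma> (a + b) = \<sigma> a + \<sigma> b"
    and \<sigma>_mult: "\<sigma> (a * b) = \<sigma> a * \<sigma> b"
    and \<sigma>_one: "\<sigma> 1 = 1"
begin

abbreviation skew (infixl "\<cdot>" 70) where "p \<cdot> q \<equiv> skew_mult \<sigma> p q"

lemma \<sigma>_0: "\<sigma> 0 = 0"
  using \<sigma>_add[of 0 0] by (metis add.right_neutral add_cancel_right_right)

lemma \<sigma>_eq_0_iff: "\<sigma> a = 0 \<longleftrightarrow> a = 0"
proof
  assume "\<sigma> a = 0"
  then have "a * inverse a \<noteq> 1"
    using \<sigma>_mult[of a "inverse a"] \<sigma>_one by auto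
  then show "a = 0" using right_inverse[of a] by blast
qed (simp add: \<sigma>_0)

lemma \<sigma>_sum: "\<sigma> (sum g A) = (\<Sum>i\<in>A. \<sigma> (g i))"
  by (induction A rule: infinite_finite_induct) (auto simp: \<sigma>_0 \<sigma>_add)

lemma \<sigma>_pow_0: "(\<sigma> ^^ i) 0 = 0"
  by (induction i) (auto simp: \<sigma>_0)

lemma \<sigma>_pow_one: "(\<sigma> ^^ i) 1 = 1"
  by (induction i) (auto simp: \<sigma>_one)

lemma \<sigma>_pow_add: "(\<sigma> ^^ i) (a + b) = (\<sigma> ^^ i) a + (\<sigma> ^^ i) b"
  by (induction i) (auto simp: \<sigma>_add)

lemma \<sigma>_pow_eq_0_iff: "(\<sigma> ^^ i) a = 0 \<longleftrightarrow> a = 0"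
  by (induction i) (auto simp: \<sigma>_eq_0_iff)

text \<open>Replacing the degree bounds by the single bound \<open>k\<close> lets bilinearity and
  compatibility with \<sigma> be checked term by term.\<close>

lemma coeff_skew: "coeff (p \<cdot> q) k = (\<Sum>i\<le>k. coeff p i * (\<sigma> ^^ i) (coeff q (k - i)))"
proof -
  let ?g = "\<lambda>i. if i \<le> k then coeff p i * (\<sigma> ^^ i) (coeff q (k - i)) else 0"
  have "(\<Sum>j\<le>degree q. coeff (monom (coeff p i * (\<sigma> ^^ i) (coeff q j)) (i + j)) k) = ?g i" for i
  proof -
    have "(\<Sum>j\<le>degree q. coeff (monom (coeff p i * (\<sigma> ^^ i) (coeff q j)) (i + j)) k)
        = (\<Sum>j\<le>degree q. if j = k - i then ?g i else 0)"
      by (rule sum.cong) auto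
    also have "\<dots> = ?g i"
      by (auto simp: coeff_eq_0 \<sigma>_pow_0)
    finally show ?thesis .
  qed
  then have "coeff (p \<cdot> q) k = (\<Sum>i\<le>degree p. ?g i)"
    by (simp add: skew_mult_def coeff_sum)
  \<comment> \<open>Beyond \<open>degree p\<close> the coefficients vanish, beyond \<open>k\<close>
    the guard in \<open>?g\<close> does; both ranges therefore extend to their union.\<close>
  also have "\<dots> = (\<Sum>i\<in>{..degree p} \<union> {..k}. ?g i)"
    by (rule sum.mono_neutral_left) (auto simp: coeff_eq_0)
  also have "\<dots> = (\<Sum>i\<le>k. ?g i)"
    by (rule sum.mono_neutral_right) auto
  finally show ?thesis by simp
qed

text \<open>Here \<open>pCons a p\<close> is a + p x, and x q = \<sigma>(q) x, where right
  multiplication by x is \<open>pCons 0\<close>. This recursion carries the proof of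
  associativity.\<close>

lemma skew_pCons_left: "pCons a p \<cdot> q = smult a q + pCons 0 (p \<cdot> map_poly \<sigma> q)"
proof (rule poly_eqI)
  fix k
  show "coeff (pCons a p \<cdot> q) k = coeff (smult a q + pCons 0 (p \<cdot> map_poly \<sigma> q)) k"
  proof (cases k)
    case 0
    then show ?thesis by (simp add: coeff_skew)
  next
    case (Suc k')
    then show ?thesis
      unfolding coeff_skew coeff_add coeff_smult Suc sum.atMost_Suc_shift
      by (simp add: coeff_skew coeff_map_poly \<sigma>_0 funpow_swap1)
  qed
qed

lemma skew_0_left [simp]: "0 \<cdot> q = 0"
  by (rule poly_eqI) (simp add: coeff_skew)

lemma skew_0_right [simp]: "p \<cdot> 0 = 0"
  by (rule poly_eqI) (simp add: coeff_skew \<sigma>_pow_0)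

lemma skew_add_left: "(p + q) \<cdot> r = p \<cdot> r + q \<cdot> r"
  by (rule poly_eqI) (simp add: coeff_skew ring_distribs sum.distrib)

lemma skew_add_right: "p \<cdot> (q + r) = p \<cdot> q + p \<cdot> r"
  by (rule poly_eqI) (simp add: coeff_skew ring_distribs sum.distrib \<sigma>_pow_add)

lemma skew_diff_left: "(p - q) \<cdot> r = p \<cdot> r - q \<cdot> r"
  using skew_add_left[of "p - q" q r] by (simp add: algebra_simps)

lemma skew_diff_right: "p \<cdot> (q - r) = p \<cdot> q - p \<cdot> r"
  using skew_add_right[of p "q - r" r] by (simp add: algebra_simps)

lemma skew_smult_left: "smult a p \<cdot> q = smult a (p \<cdot> q)"
  by (rule poly_eqI) (simp add: coeff_skew sum_distrib_left mult.assoc)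

lemma skew_const_left [simp]: "[:a:] \<cdot> q = smult a q"
  by (simp add: skew_pCons_left)

lemma skew_one_left [simp]: "1 \<cdot> q = q"
  unfolding one_pCons by (subst skew_const_left) simp

lemma coeff_skew_const: "coeff (p \<cdot> [:b:]) k = coeff p k * (\<sigma> ^^ k) b"
proof -
  have "coeff (p \<cdot> [:b:]) k = (\<Sum>i\<le>k. if i = k then coeff p k * (\<sigma> ^^ k) b else 0)"
    unfolding coeff_skew
    by (rule sum.cong) (auto simp: coeff_pCons \<sigma>_pow_0 split: nat.split)
  then show ?thesis by simp
qed

lemma skew_one_right [simp]: "p \<cdot> 1 = p"
  by (rule poly_eqI) (simp add: one_pCons coeff_skew_const \<sigma>_pow_one)

lemma map_poly_skew: "map_poly \<sigma> (p \<cdot> q) = map_poly \<sigma> p \<cdot> map_poly \<sigma> q"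
  by (rule poly_eqI) (simp add: coeff_skew coeff_map_poly \<sigma>_0 \<sigma>_sum \<sigma>_mult funpow_swap1)

text \<open>Induction on the left factor; \<open>q\<close> and \<open>r\<close> stay arbitrary
  because \<open>skew_pCons_left\<close> replaces them by their images under
  \<open>map_poly \<sigma>\<close>.\<close>

lemma skew_assoc: "(p \<cdot> q) \<cdot> r = p \<cdot> (q \<cdot> r)"
proof (induction p arbitrary: q r rule: pCons_induct)
  case (pCons a p)
  show ?case
    using pCons.IH
    by (simp add: skew_pCons_left skew_add_left skew_smult_left map_poly_skew)
qed simp

lemma coeff_skew_degree:
  "coeff (p \<cdot> q) (degree p + degree q) = lead_coeff p * (\<sigma> ^^ degree p) (lead_coeff q)"
proof -
  have "coeff p i * (\<sigma> ^^ i) (coeff q (degree p + degree q - i)) = 0"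
    if "i \<noteq> degree p" for i
    using that by (cases "i < degree p") (auto simp: coeff_eq_0 \<sigma>_pow_0)
  then have "coeff (p \<cdot> q) (degree p + degree q) = (\<Sum>i\<le>degree p + degree q.
      if i = degree p then lead_coeff p * (\<sigma> ^^ degree p) (lead_coeff q) else 0)"
    unfolding coeff_skew by (intro sum.cong) auto
  then show ?thesis by simp
qed

lemma degree_skew_le: "degree (p \<cdot> q) \<le> degree p + degree q"
proof (rule degree_le, safe)
  fix k assume "degree p + degree q < k"
  then have "coeff p i * (\<sigma> ^^ i) (coeff q (k - i)) = 0" for i
    by (cases "i \<le> degree p") (auto simp: coeff_eq_0 \<sigma>_pow_0)
  then show "coeff (p \<cdot> q) k = 0" unfolding coeff_skew by (intro sum.neutral) blast
qed

lemma degree_skew: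
  assumes "p \<noteq> 0" "q \<noteq> 0"
  shows "degree (p \<cdot> q) = degree p + degree q"
  using degree_skew_le[of p q] assms le_degree[of "p \<cdot> q" "degree p + degree q"]
  by (simp add: coeff_skew_degree \<sigma>_pow_eq_0_iff)

section \<open>The ring R and its ideals\<close>

lemma ring_skew: "ring (skew_ring \<sigma>)"
proof (rule ringI)
  show "abelian_group (skew_ring \<sigma>)"
  proof (rule abelian_groupI)
    fix x assume "x \<in> carrier (skew_ring \<sigma>)"
    show "\<exists>y\<in>carrier (skew_ring \<sigma>). y \<oplus>\<^bsub>skew_ring \<sigma>\<^esub> x = \<zero>\<^bsub>skew_ring \<sigma>\<^esub>"
      by (rule bexI[of _ "- x"]) (auto simp: skew_ring_def)
  qed (auto simp: skew_ring_def)
  show "Group.monoid (skew_ring \<sigma>)"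
    by unfold_locales (auto simp: skew_ring_def skew_assoc)
qed (auto simp: skew_ring_def skew_add_left skew_add_right)

lemma idealI_skew:
  assumes "0 \<in> I" "\<And>a b. a \<in> I \<Longrightarrow> b \<in> I \<Longrightarrow> a + b \<in> I" "\<And>a x. a \<in> I \<Longrightarrow> x \<cdot> a \<in> I"
    "\<And>a x. a \<in> I \<Longrightarrow> a \<cdot> x \<in> I"
  shows "ideal I (skew_ring \<sigma>)"
proof (rule idealI[OF ring_skew])
  interpret ring "skew_ring \<sigma>" by (rule ring_skew)
  \<comment> \<open>Negation is left multiplication by the constant -1, so closure under it is a
    case of closure under left multiplication.\<close>
  have inv: "\<ominus>\<^bsub>skew_ring \<sigma>\<^esub> a = [:-1:] \<cdot> a" for a
    by (rule minus_equality) (auto simp: skew_ring_def)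
  show "subgroup I (add_monoid (skew_ring \<sigma>))"
  proof (rule add.subgroupI)
    fix a assume "a \<in> I"
    then show "\<ominus>\<^bsub>skew_ring \<sigma>\<^esub> a \<in> I" unfolding inv by (rule assms(3))
  qed (use assms(1,2) in \<open>auto simp: skew_ring_def\<close>)
qed (use assms(3,4) in \<open>simp_all add: skew_ring_def\<close>)

text \<open>Centrality of \<open>h\<close> makes the left ideal R h two-sided: q h x = q x
  h.\<close>

lemma genideal_central_subset:
  assumes "h \<in> ring_centre (skew_ring \<sigma>)"
  shows "genideal (skew_ring \<sigma>) {h} \<subseteq> left_mults \<sigma> h"
proof (rule ring.genideal_minimal[OF ring_skew])
  have h: "h \<cdot> y = y \<cdot> h" for y
    using assms by (auto simp: ring_centre_def skew_ring_def)
  show "{h} \<subseteq> left_mults \<sigma> h"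
    unfolding left_mults_def by (auto intro: exI[of _ 1])
  show "ideal (left_mults \<sigma> h) (skew_ring \<sigma>)"
  proof (rule idealI_skew)
    show "0 \<in> left_mults \<sigma> h"
      unfolding left_mults_def by (auto intro: exI[of _ 0])
    fix a x assume "a \<in> left_mults \<sigma> h"
    then obtain q where q: "a = q \<cdot> h" by (auto simp: left_mults_def)
    have "a \<cdot> x = (q \<cdot> x) \<cdot> h"
      by (simp add: q skew_assoc h)
    then show "a \<cdot> x \<in> left_mults \<sigma> h" by (auto simp: left_mults_def)
    show "x \<cdot> a \<in> left_mults \<sigma> h"
      by (auto simp: left_mults_def q skew_assoc[symmetric])
  qed (auto simp: left_mults_def skew_add_left[symmetric])
qed

lemma left_mults_add: "a \<in> left_mults \<sigma> f \<Longrightarrow> b \<in> left_mults \<sigma> f \<Longrightarrow> a + b \<in> left_mults \<sigma> f"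
  by (auto simp: left_mults_def skew_add_left[symmetric])

lemma left_mults_diff: "a \<in> left_mults \<sigma> f \<Longrightarrow> b \<in> left_mults \<sigma> f \<Longrightarrow> a - b \<in> left_mults \<sigma> f"
  by (auto simp: left_mults_def skew_diff_left[symmetric])

lemma left_mults_skew: "a \<in> left_mults \<sigma> f \<Longrightarrow> x \<cdot> a \<in> left_mults \<sigma> f"
  by (auto simp: left_mults_def skew_assoc[symmetric])

lemma left_mults_smult: "a \<in> left_mults \<sigma> f \<Longrightarrow> smult c a \<in> left_mults \<sigma> f"
  using left_mults_skew[of a f "[:c:]"] by simp

lemma left_mults_0: "0 \<in> left_mults \<sigma> f"
  by (auto simp: left_mults_def intro: exI[of _ 0])

lemma left_mults_self: "f \<in> left_mults \<sigma> f"
  by (auto simp: left_mults_def intro: exI[of _ 1])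

section \<open>Right division by a monic polynomial\<close>

lemma degree_left_mults:
  assumes "a \<in> left_mults \<sigma> f" "a \<noteq> 0"
  shows "degree f \<le> degree a"
proof -
  obtain q where q: "a = q \<cdot> f" using assms(1) by (auto simp: left_mults_def)
  with assms(2) have "q \<noteq> 0" "f \<noteq> 0" by auto
  then show ?thesis using degree_skew[of q f] q by simp
qed

lemma right_division_exists:
  assumes "lead_coeff f = 1" "degree f > 0"
  shows "\<exists>r. degree r < degree f \<and> a - r \<in> left_mults \<sigma> f"
proof (induction "degree a" arbitrary: a rule: less_induct)
  case less
  show ?case
  proof (cases "degree a < degree f")
    case True
    then show ?thesis using left_mults_0 by force
  next
    case False
    define k where "k = degree a - degree f"
    \<comment> \<open>This multiple of \<open>f\<close> has the leading term of \<open>a\<close>: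
      powers of \<sigma> fix the leading coefficient 1 of \<open>f\<close>.\<close>
    define g where "g = monom (lead_coeff a) k \<cdot> f"
    have a: "degree a = k + degree f" "a \<noteq> 0" using False assms by (auto simp: k_def)
    have mk: "degree (monom (lead_coeff a) k) = k" using a(2) by (intro degree_monom_eq) simp
    have dg: "degree g \<le> degree a"
      unfolding g_def a(1) using degree_skew_le[of "monom (lead_coeff a) k" f] mk unfolding a(1) by simp
    have "coeff g (degree a) = lead_coeff a"
      using coeff_skew_degree[of "monom (lead_coeff a) k" f] assms
      by (simp add: g_def a(1) mk[unfolded a(1)] \<sigma>_pow_one)
    \<comment> \<open>The case \<open>a = g\<close> is covered too, since \<open>degree a\<close> is
      at least \<open>degree f\<close>, hence positive.\<close>
    then have "degree (a - g) < degree a"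
      using degree_diff_le[OF order_refl dg] eq_zero_or_degree_less[of "a - g" "degree a"]
        False assms(2) by auto
    from less[OF this] obtain r where r: "degree r < degree f" "a - g - r \<in> left_mults \<sigma> f"
      by blast
    have "g \<in> left_mults \<sigma> f" by (auto simp: g_def left_mults_def)
    from left_mults_add[OF r(2) this] r(1) show ?thesis by (auto simp: algebra_simps)
  qed
qed

text \<open>Two remainders differ by a multiple of \<open>f\<close> of degree below
  \<open>degree f\<close>, which must be 0. So a remainder only has to be recognised, never
  computed.\<close>

lemma rmod_eqI:
  assumes "degree r < degree f" "a - r \<in> left_mults \<sigma> f"
  shows "rmod \<sigma> a f = r"
  unfolding rmod_def
proof (rule the_equality)
  show "degree r < degree f \<and> (\<exists>q. a = q \<cdot> f + r)"
    using assms by (auto simp: left_mults_def algebra_simps)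
next
  fix r' assume r': "degree r' < degree f \<and> (\<exists>q. a = q \<cdot> f + r')"
  then have "a - r' \<in> left_mults \<sigma> f" by (auto simp: left_mults_def)
  from left_mults_diff[OF assms(2) this] have "r' - r \<in> left_mults \<sigma> f" by simp
  from degree_left_mults[OF this] degree_diff_less[of r' "degree f" r] assms r'
  show "r' = r" by auto
qed

end

section \<open>Remainders modulo Rf\<close>

locale monic_skew = skew_poly +
  fixes f :: "'a::field poly"
  assumes f_monic: "lead_coeff f = 1" and f_deg: "degree f > 0"
begin

abbreviation red where "red a \<equiv> rmod \<sigma> a f"
abbreviation Rf where "Rf \<equiv> left_mults \<sigma> f"

lemma degree_red: "degree (red a) < degree f"
  and red_congruent: "a - red a \<in> Rf"
  using right_division_exists[OF f_monic f_deg, of a] rmod_eqI by auto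

lemma red_eq_iff: "red a = red b \<longleftrightarrow> a - b \<in> Rf"
proof
  assume "red a = red b"
  then show "a - b \<in> Rf"
    using left_mults_diff[OF red_congruent[of a] red_congruent[of b]] by simp
next
  assume "a - b \<in> Rf"
  from left_mults_add[OF this red_congruent[of b]] show "red a = red b"
    by (intro rmod_eqI degree_red) simp
qed

lemma red_id: "degree a < degree f \<Longrightarrow> red a = a"
  by (rule rmod_eqI) (auto simp: left_mults_0)

text \<open>Rf is a left ideal, so a right factor may be reduced first; a left factor admits no such
  rule in general.\<close>

lemma red_skew_red: "red (a \<cdot> red b) = red (a \<cdot> b)"
  using left_mults_skew[OF red_congruent[of b], of a] red_eq_iff[of "a \<cdot> b" "a \<cdot> red b"]
  by (simp add: skew_diff_right)

end

section \<open>Quadratic subfields\<close>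

text \<open>Index two enters through \<open>decomposition\<close>: 1 and \<open>\<theta>\<close>
  span L over \<open>L'\<close>. The element \<open>\<theta>\<close> is kept general because the
  involution over \<open>L'\<close> is built from some element outside \<open>L'\<close> before
  \<gamma> is known to be one.\<close>

locale quadratic_subfield =
  fixes L' :: "'a::field set" and \<theta> :: 'a
  assumes one_mem: "1 \<in> L'"
    and add_mem: "a \<in> L' \<Longrightarrow> b \<in> L' \<Longrightarrow> a + b \<in> L'"
    and mult_mem: "a \<in> L' \<Longrightarrow> b \<in> L' \<Longrightarrow> a * b \<in> L'"
    and uminus_mem: "a \<in> L' \<Longrightarrow> - a \<in> L'"
    and inverse_mem: "a \<in> L' \<Longrightarrow> inverse a \<in> L'"
    and decomposition: "\<exists>c'\<in>L'. \<exists>c''\<in>L'. c = c' + \<theta> * c''"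
    and \<theta>_notin: "\<theta> \<notin> L'"
begin

lemma diff_mem: "a \<in> L' \<Longrightarrow> b \<in> L' \<Longrightarrow> a - b \<in> L'"
  using add_mem[of a "- b"] uminus_mem by simp

lemma zero_mem: "0 \<in> L'"
  using diff_mem[OF one_mem one_mem] by simp

lemma \<theta>_nonzero: "\<theta> \<noteq> 0"
  using \<theta>_notin zero_mem by auto

text \<open>Two decompositions with different second parts would make \<open>\<theta>\<close> a
  quotient of elements of \<open>L'\<close>.\<close>

lemma snd_part_eq:
  assumes "c' \<in> L'" "c'' \<in> L'"
  shows "snd_part L' \<theta> (c' + \<theta> * c'') = c''"
  unfolding snd_part_def
proof (rule the_equality)
  fix e assume "e \<in> L' \<and> (\<exists>e'\<in>L'. c' + \<theta> * c'' = e' + \<theta> * e)"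
  then obtain e' where e: "e \<in> L'" "e' \<in> L'" "\<theta> * (c'' - e) = e' - c'"
    by (auto simp: algebra_simps)
  show "e = c''"
  proof (rule ccontr)
    assume "e \<noteq> c''"
    then have "\<theta> = \<theta> * (c'' - e) * inverse (c'' - e)" by simp
    also have "\<dots> \<in> L'"
      unfolding e(3) by (intro mult_mem diff_mem inverse_mem assms e)
    finally show False using \<theta>_notin by blast
  qed
qed (use assms in auto)

lemma snd_part_mem: "snd_part L' \<theta> c \<in> L'"
  using decomposition[of c] snd_part_eq by auto

lemma fst_part_mem: "c - \<theta> * snd_part L' \<theta> c \<in> L'"
  using decomposition[of c] snd_part_eq by auto

lemma snd_part_of_mem: "c \<in> L' \<Longrightarrow> snd_part L' \<theta> c = 0"
  using snd_part_eq[of c 0] zero_mem by simp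

end

section \<open>The nuclei\<close>

text \<open>The Galois group and the bound of \<open>f\<close> are hidden behind
  \<open>\<sigma>_mem\<close> and \<open>annihilator\<close>; the computation of the nuclei uses
  them only in this form.\<close>

locale twisted_algebra = monic_skew \<sigma> f + quadratic_subfield L' \<gamma>
  for \<sigma> :: "'a::field \<Rightarrow> 'a" and f :: "'a poly" and L' :: "'a set" and \<gamma> :: 'a +
  assumes deg_gt_1: "degree f > 1"
    and \<sigma>_mem: "a \<in> L' \<Longrightarrow> \<sigma> a \<in> L'"
    and \<gamma>_f0_notin: "\<gamma> / coeff f 0 \<notin> L'"
    and annihilator: "(\<And>c. w \<cdot> c \<in> left_mults \<sigma> f) \<Longrightarrow> w \<noteq> 0 \<Longrightarrow> 2 * degree f \<le> degree w"
begin

lemma \<sigma>_pow_mem: "a \<in> L' \<Longrightarrow> (\<sigma> ^^ i) a \<in> L'"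
  by (induction i) (auto simp: \<sigma>_mem)

lemma f0_nonzero: "coeff f 0 \<noteq> 0"
  using \<gamma>_f0_notin zero_mem by auto

definition twist :: "'a poly \<Rightarrow> 'a poly" where
  "twist a = a - smult (\<gamma> / coeff f 0 * snd_part L' \<gamma> (coeff a 0)) f"

text \<open>By \<open>twist_mem\<close> and \<open>twist_red\<close> this is exactly the set of
  values of \<open>twist\<close> on the carrier.\<close>

definition twisted :: "'a poly set" where
  "twisted = {v. degree v \<le> degree f \<and> coeff v 0 \<in> L' \<and>
     (\<exists>e\<in>L'. coeff v (degree f) = \<gamma> / coeff f 0 * e)}"

definition star (infixl "\<star>" 70) where "a \<star> b = red (twist a \<cdot> b)"

lemma twist_congruent: "twist a - a \<in> Rf"
proof -
  let ?k = "\<gamma> / coeff f 0 * snd_part L' \<gamma> (coeff a 0)"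
  have "twist a - a = smult (- ?k) f" by (simp add: twist_def)
  then show ?thesis by (simp only: left_mults_smult[OF left_mults_self])
qed

lemma twist_eq_self: "coeff a 0 \<in> L' \<Longrightarrow> twist a = a"
  by (simp add: twist_def snd_part_of_mem)

lemma coeff_twist_0: "coeff (twist a) 0 \<in> L'"
  using fst_part_mem[of "coeff a 0"] f0_nonzero by (simp add: twist_def)

lemma degree_twist: "degree a < degree f \<Longrightarrow> degree (twist a) \<le> degree f"
  unfolding twist_def by (intro degree_diff_le) auto

lemma twist_mem: "degree a < degree f \<Longrightarrow> twist a \<in> twisted"
proof -
  assume a: "degree a < degree f"
  let ?e = "- snd_part L' \<gamma> (coeff a 0)"
  have "coeff (twist a) (degree f) = \<gamma> / coeff f 0 * ?e"
    using a f_monic by (simp add: twist_def coeff_eq_0)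
  moreover have "?e \<in> L'" by (intro uminus_mem snd_part_mem)
  ultimately show ?thesis
    using degree_twist[OF a] coeff_twist_0[of a] by (auto simp only: twisted_def mem_Collect_eq)
qed

lemma twist_red:
  assumes "v \<in> twisted"
  shows "twist (red v) = v"
proof -
  from assms obtain e where e: "degree v \<le> degree f" "coeff v 0 \<in> L'" "e \<in> L'"
    "coeff v (degree f) = \<gamma> / coeff f 0 * e"
    by (auto simp: twisted_def)
  \<comment> \<open>Cancelling the top term of \<open>v\<close> with a multiple of \<open>f\<close>
    gives its remainder. This changes the constant coefficient by \<open>\<gamma> * (- e)\<close>,
    from which \<open>twist\<close> recovers the multiple removed.\<close>
  define y where "y = v - smult (coeff v (degree f)) f"
  have "degree y \<le> degree f" "coeff y (degree f) = 0"
    using e(1) f_monic by (auto simp: y_def intro!: degree_diff_le)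
  then have "degree y < degree f"
    using eq_zero_or_degree_less[of y "degree f"] f_deg by auto
  moreover have "v - y \<in> Rf"
    by (simp add: y_def left_mults_smult left_mults_self)
  ultimately have "red v = y" by (rule rmod_eqI)
  moreover have "coeff y 0 = coeff v 0 + \<gamma> * (- e)"
    using e(4) f0_nonzero by (simp add: y_def)
  ultimately show ?thesis
    using snd_part_eq[OF e(2) uminus_mem[OF e(3)]]
    by (simp add: twist_def y_def e(4))
qed

lemma star_D_eq: "star_D \<sigma> L' \<gamma> f a b = a \<star> b"
  by (simp add: star_D_def star_def twist_def)

lemma degree_star: "degree (a \<star> b) < degree f"
  by (simp add: star_def degree_red)

text \<open>Twisting the right factor changes it by an element of the left ideal Rf, which the
  reduction does not see.\<close>

lemma star_eq_red_twist: "a \<star> b = red (twist a \<cdot> twist b)"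
  using left_mults_skew[OF twist_congruent[of b], of "twist a"]
    red_eq_iff[of "twist a \<cdot> twist b" "twist a \<cdot> b"]
  by (simp add: star_def skew_diff_right)

lemma star_star: "a \<star> (b \<star> c) = red (twist a \<cdot> twist b \<cdot> c)"
  by (simp add: star_def red_skew_red skew_assoc)

text \<open>If the product of the two twists is itself a twist, it is the twist of its own
  remainder, which is \<open>a \<star> b\<close>.\<close>

lemma associative_if_twisted:
  assumes "twist a \<cdot> twist b \<in> twisted"
  shows "a \<star> (b \<star> c) = (a \<star> b) \<star> c"
proof -
  have "twist (a \<star> b) = twist a \<cdot> twist b"
    using assms by (simp add: star_eq_red_twist twist_red)
  then show ?thesis unfolding star_star by (simp add: star_def[of "a \<star> b"])
qed

text \<open>Partial converse: the difference \<open>w\<close> annihilates R/Rf, and its degree is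
  too small for a nonzero annihilator.\<close>

lemma twisted_if_associative:
  assumes assoc: "\<And>c. degree c < degree f \<Longrightarrow> a \<star> (b \<star> c) = (a \<star> b) \<star> c"
    and deg: "degree (twist a \<cdot> twist b) < 2 * degree f"
  shows "twist a \<cdot> twist b \<in> twisted"
proof -
  define w where "w = twist a \<cdot> twist b - twist (a \<star> b)"
  have "w \<cdot> c \<in> Rf" for c
  proof -
    \<comment> \<open>Associativity is given only for remainders; it extends to all \<open>c\<close>
      because \<open>c - red c\<close> lies in Rf.\<close>
    have "w \<cdot> red c \<in> Rf"
      using assoc[OF degree_red[of c]]
      unfolding star_star star_def[of "a \<star> b"] red_eq_iff w_def by (simp add: skew_diff_left)
    from left_mults_add[OF this left_mults_skew[OF red_congruent[of c], of w]]
    show ?thesis by (simp add: skew_diff_right)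
  qed
  moreover have "degree w < 2 * degree f"
    unfolding w_def using deg degree_twist[OF degree_star[of a b]] f_deg
    by (intro degree_diff_less) auto
  ultimately have "w = 0" using annihilator[of w] by fastforce
  then show ?thesis using twist_mem[OF degree_star[of a b]] by (simp add: w_def)
qed

abbreviation A where "A \<equiv> algebra_D \<sigma> L' \<gamma> f"

lemma carrier_A: "a \<in> carrier A \<longleftrightarrow> degree a < degree f"
  by (simp add: algebra_D_def)

lemma mult_A: "a \<otimes>\<^bsub>A\<^esub> b = a \<star> b"
  by (simp add: algebra_D_def star_D_eq)

lemma twist_X: "twist [:0, 1:] = [:0, 1:]"
  by (rule twist_eq_self) (simp add: zero_mem)

lemma twist_const_mem: "a \<in> L' \<Longrightarrow> twist [:a:] = [:a:]"
  by (rule twist_eq_self) simp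

lemma degree_twist_\<gamma>: "degree (twist [:\<gamma>:]) = degree f"
proof -
  have "snd_part L' \<gamma> \<gamma> = 1"
    using snd_part_eq[OF zero_mem one_mem] by simp
  then have "coeff (twist [:\<gamma>:]) (degree f) \<noteq> 0"
    using f0_nonzero \<theta>_nonzero f_monic f_deg by (simp add: twist_def coeff_eq_0)
  then have "degree f \<le> degree (twist [:\<gamma>:])" by (rule le_degree)
  with degree_twist[of "[:\<gamma>:]"] f_deg show ?thesis by simp
qed

text \<open>Common end of the left and middle cases. The premises are conditional because degrees
  add only for nonzero factors.\<close>

lemma nucleus_constI:
  assumes "degree a < degree f"
    and "twist a \<noteq> 0 \<Longrightarrow> degree (twist a) < degree f"
    and "twist a \<noteq> 0 \<Longrightarrow> degree (twist a) = 0"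
  shows "a \<in> (\<lambda>c. [:c:]) ` L'"
proof -
  let ?k = "\<gamma> / coeff f 0 * snd_part L' \<gamma> (coeff a 0)"
  \<comment> \<open>A twist of degree below \<open>degree f\<close> has had no multiple of
    \<open>f\<close> subtracted, so it equals \<open>a\<close>.\<close>
  have "degree (twist a) < degree f" using assms(2) f_deg by fastforce
  then have "coeff (twist a) (degree f) = 0" by (rule coeff_eq_0)
  then have "?k = 0" using assms(1) f_monic by (simp add: twist_def coeff_eq_0)
  then have "twist a = a" by (simp add: twist_def)
  then have "degree a = 0" "coeff a 0 \<in> L'"
    using assms(3) coeff_twist_0[of a] by (cases "a = 0"; simp)+
  then show ?thesis by (metis degree_0_id imageI)
qed

lemma left_nucleus_A: "left_nucleus A = (\<lambda>c. [:c:]) ` L'"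
proof (intro equalityI subsetI)
  fix a assume "a \<in> left_nucleus A"
  then have a: "degree a < degree f"
    and assoc: "\<And>b c. degree b < degree f \<Longrightarrow> degree c < degree f \<Longrightarrow> a \<star> (b \<star> c) = (a \<star> b) \<star> c"
    by (auto simp: left_nucleus_def carrier_A mult_A)
  \<comment> \<open>The product of the twists is in \<open>twisted\<close>, so its degree, the sum
    of the two degrees, is at most \<open>degree f\<close>.\<close>
  have bound: "degree (twist a) + degree (twist b) \<le> degree f"
    if "degree b < degree f" "degree (twist a) + degree (twist b) < 2 * degree f"
      "twist a \<noteq> 0" "twist b \<noteq> 0" for b
    using twisted_if_associative[OF assoc[OF that(1)]] degree_skew[OF that(3,4)] that(2)
    by (simp add: twisted_def)
  show "a \<in> (\<lambda>c. [:c:]) ` L'"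
  proof (rule nucleus_constI[OF a])
    assume nz: "twist a \<noteq> 0"
    \<comment> \<open>Testing against x excludes degree \<open>degree f\<close>; only then is the
      sum of degrees small enough to test against \<gamma>, whose twist has full degree.\<close>
    show 1: "degree (twist a) < degree f"
      using bound[of "[:0, 1:]"] degree_twist[OF a] deg_gt_1 nz by (simp add: twist_X)
    show "degree (twist a) = 0"
      using bound[of "[:\<gamma>:]"] degree_twist_\<gamma> f_deg 1 nz by fastforce
  qed
next
  fix a assume "a \<in> (\<lambda>c. [:c:]) ` L'"
  then obtain c where c: "a = [:c:]" "c \<in> L'" by auto
  have "twist a \<cdot> twist b \<in> twisted" if "degree b < degree f" for b
  proof -
    from twist_mem[OF that] obtain e where "degree (twist b) \<le> degree f"
      "coeff (twist b) 0 \<in> L'" "e \<in> L'" "coeff (twist b) (degree f) = \<gamma> / coeff f 0 * e"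
      by (auto simp: twisted_def)
    then show ?thesis
      using c(2) by (auto simp: twisted_def twist_const_mem c(1) mult_mem
        intro!: bexI[of _ "c * e"])
  qed
  then show "a \<in> left_nucleus A"
    using associative_if_twisted f_deg by (simp add: left_nucleus_def carrier_A mult_A c(1))
qed

lemma middle_nucleus_A: "middle_nucleus A = (\<lambda>c. [:c:]) ` L'"
proof (intro equalityI subsetI)
  fix b assume "b \<in> middle_nucleus A"
  then have b: "degree b < degree f"
    and assoc: "\<And>a c. degree a < degree f \<Longrightarrow> degree c < degree f \<Longrightarrow> a \<star> (b \<star> c) = (a \<star> b) \<star> c"
    by (auto simp: middle_nucleus_def carrier_A mult_A)
  have bound: "degree (twist a) + degree (twist b) \<le> degree f"
    if "degree a < degree f" "degree (twist a) + degree (twist b) < 2 * degree f"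
      "twist a \<noteq> 0" "twist b \<noteq> 0" for a
    using twisted_if_associative[OF assoc[OF that(1)]] degree_skew[OF that(3,4)] that(2)
    by (simp add: twisted_def)
  show "b \<in> (\<lambda>c. [:c:]) ` L'"
  proof (rule nucleus_constI[OF b])
    assume nz: "twist b \<noteq> 0"
    show 1: "degree (twist b) < degree f"
      using bound[of "[:0, 1:]"] degree_twist[OF b] deg_gt_1 nz by (simp add: twist_X)
    show "degree (twist b) = 0"
      using bound[of "[:\<gamma>:]"] degree_twist_\<gamma> f_deg 1 nz by fastforce
  qed
next
  fix b assume "b \<in> (\<lambda>c. [:c:]) ` L'"
  then obtain c where c: "b = [:c:]" "c \<in> L'" by auto
  \<comment> \<open>Right multiplication by \<open>c\<close> multiplies the top coefficient by a
    power of \<sigma> applied to \<open>c\<close>, which is still in \<open>L'\<close>.\<close>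
  have "twist a \<cdot> twist b \<in> twisted" if "degree a < degree f" for a
  proof -
    from twist_mem[OF that] obtain e where e: "degree (twist a) \<le> degree f"
      "coeff (twist a) 0 \<in> L'" "e \<in> L'" "coeff (twist a) (degree f) = \<gamma> / coeff f 0 * e"
      by (auto simp: twisted_def)
    have "degree (twist a \<cdot> [:c:]) \<le> degree f"
      using degree_skew_le[of "twist a" "[:c:]"] e(1) by simp
    then show ?thesis
      using e \<sigma>_pow_mem[OF c(2), of "degree f"] c(2)
      by (auto simp: twisted_def twist_const_mem c coeff_skew_const mult_mem
        intro!: bexI[of _ "e * (\<sigma> ^^ degree f) c"])
  qed
  then show "b \<in> middle_nucleus A"
    using associative_if_twisted f_deg by (simp add: middle_nucleus_def carrier_A mult_A c(1))
qed

lemma twist_skew_congruent: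
  assumes "f \<cdot> c \<in> Rf"
  shows "twist a \<cdot> c - a \<cdot> c \<in> Rf"
proof -
  let ?k = "\<gamma> / coeff f 0 * snd_part L' \<gamma> (coeff a 0)"
  have "twist a \<cdot> c - a \<cdot> c = smult (- ?k) (f \<cdot> c)"
    by (simp add: twist_def skew_diff_left skew_smult_left)
  then show ?thesis by (simp only: left_mults_smult[OF assms])
qed

text \<open>For \<open>c\<close> in the eigenring the correction by a multiple of \<open>f\<close>
  is absorbed, leaving the ordinary product modulo \<open>f\<close>.\<close>

lemma star_eigen: "f \<cdot> c \<in> Rf \<Longrightarrow> a \<star> c = red (a \<cdot> c)"
  unfolding star_def red_eq_iff by (rule twist_skew_congruent)

lemma right_nucleus_A: "right_nucleus A = {c. degree c < degree f \<and> f \<cdot> c \<in> Rf}"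
proof (intro equalityI subsetI)
  fix c assume "c \<in> right_nucleus A"
  then have deg_c: "degree c < degree f"
    and assoc: "\<And>a b. degree a < degree f \<Longrightarrow> degree b < degree f \<Longrightarrow> a \<star> (b \<star> c) = (a \<star> b) \<star> c"
    by (auto simp: right_nucleus_def carrier_A mult_A)
  \<comment> \<open>The product of x and \<open>b\<close> is the smallest power of x that has to be
    reduced, so \<open>f\<close> itself enters the associativity equation.\<close>
  define b :: "'a poly" where "b = monom 1 (degree f - 1)"
  define p :: "'a poly" where "p = monom 1 (degree f)"
  have b: "degree b < degree f" "twist b = b"
    using deg_gt_1 by (auto simp: b_def degree_monom_eq zero_mem intro!: twist_eq_self)
  have xb: "[:0, 1:] \<cdot> b = p"
    using f_deg by (auto simp: skew_pCons_left b_def p_def map_poly_monom \<sigma>_0 \<sigma>_one monom_Suc[symmetric])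
  have "degree (p - f) \<le> degree f" "coeff (p - f) (degree f) = 0"
    using f_monic by (auto simp: p_def degree_monom_eq intro!: degree_diff_le)
  then have "degree (p - f) < degree f"
    using eq_zero_or_degree_less[of "p - f" "degree f"] f_deg by auto
  then have star_xb: "[:0, 1:] \<star> b = p - f"
    unfolding star_def twist_X xb by (rule rmod_eqI) (simp add: left_mults_self)
  define e where "e = snd_part L' \<gamma> (coeff (p - f) 0)"
  define k where "k = 1 + \<gamma> / coeff f 0 * e"
  \<comment> \<open>If \<open>k\<close> vanished, \<gamma>/f_0 would be the negative inverse of
    \<open>e\<close>, an element of \<open>L'\<close>.\<close>
  have "k \<noteq> 0"
  proof
    assume "k = 0"
    then have k: "\<gamma> / coeff f 0 * e = - 1" by (simp add: k_def eq_neg_iff_add_eq_0 add.commute)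
    then have "e \<noteq> 0" by auto
    then have "\<gamma> / coeff f 0 = \<gamma> / coeff f 0 * e * inverse e" by simp
    also have "\<dots> = - inverse e" unfolding k by simp
    finally have "\<gamma> / coeff f 0 = - inverse e" .
    then show False
      using \<gamma>_f0_notin uminus_mem[OF inverse_mem[OF snd_part_mem]] e_def by metis
  qed
  have "twist (p - f) = p - smult k f"
    by (simp add: twist_def k_def e_def smult_add_left)
  moreover have "[:0, 1:] \<star> (b \<star> c) = ([:0, 1:] \<star> b) \<star> c"
    using deg_gt_1 b by (intro assoc) auto
  ultimately have "red (p \<cdot> c) = red ((p - smult k f) \<cdot> c)"
    unfolding star_star twist_X b xb star_xb star_def[of "p - f"] by simp
  then have "smult k (f \<cdot> c) \<in> Rf"
    by (simp add: red_eq_iff skew_diff_left skew_smult_left)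
  from left_mults_smult[OF this, of "inverse k"] \<open>k \<noteq> 0\<close> deg_c
  show "c \<in> {c. degree c < degree f \<and> f \<cdot> c \<in> Rf}" by simp
next
  fix c assume "c \<in> {c. degree c < degree f \<and> f \<cdot> c \<in> Rf}"
  then have c: "degree c < degree f" "f \<cdot> c \<in> Rf" by auto
  have "a \<star> (b \<star> c) = (a \<star> b) \<star> c" for a b
  proof -
    have "a \<star> (b \<star> c) = red (twist a \<cdot> (b \<cdot> c))"
      unfolding star_eigen[OF c(2), of b] star_def[of a] by (rule red_skew_red)
    \<comment> \<open>The multiple q f discarded in forming \<open>a \<star> b\<close> stays in Rf
      after multiplication by \<open>c\<close>, since f c is in Rf.\<close>
    moreover have "(twist a \<cdot> b - a \<star> b) \<cdot> c \<in> Rf"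
    proof -
      obtain q where "twist a \<cdot> b - a \<star> b = q \<cdot> f"
        using red_congruent[of "twist a \<cdot> b"] by (auto simp: star_def left_mults_def)
      then show ?thesis using left_mults_skew[OF c(2)] by (simp add: skew_assoc)
    qed
    ultimately show ?thesis
      unfolding star_eigen[OF c(2), of "a \<star> b"] by (simp add: red_eq_iff skew_diff_left skew_assoc)
  qed
  then show "c \<in> right_nucleus A"
    using c(1) by (simp add: right_nucleus_def carrier_A mult_A)
qed

lemma alg_iso_right_nucleus:
  "alg_iso K (A\<lparr>carrier := right_nucleus A\<rparr>) (eigenring \<sigma> f)"
  unfolding alg_iso_def
proof (intro bexI[of _ id] ballI)
  show "id \<in> ring_iso (A\<lparr>carrier := right_nucleus A\<rparr>) (eigenring \<sigma> f)"
    unfolding right_nucleus_A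
    by (rule ring_iso_memI) (simp_all add: algebra_D_def eigenring_def star_D_eq star_eigen)
qed (simp add: algebra_D_def eigenring_def)

text \<open>Constants from \<open>L'\<close> are their own twists and multiply without reduction.
  The set \<open>M\<close> is \<open>L'\<close> for two of the nuclei and \<open>K\<close> for the
  centre.\<close>

lemma alg_iso_constants:
  assumes "M \<subseteq> L'" "N = (\<lambda>c. [:c:]) ` M"
  shows "alg_iso K (A\<lparr>carrier := N\<rparr>) (subfield_algebra M)"
  unfolding alg_iso_def
proof (intro bexI[of _ "\<lambda>p. coeff p 0"] ballI)
  have star: "[:a:] \<star> [:b:] = [:a * b:]" if "a \<in> M" for a b
  proof -
    have "a \<in> L'" using that assms(1) by blast
    then show ?thesis using f_deg by (simp add: star_def twist_const_mem red_id)
  qed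
  show "(\<lambda>p. coeff p 0) \<in> ring_iso (A\<lparr>carrier := N\<rparr>) (subfield_algebra M)"
    unfolding assms(2)
    by (rule ring_iso_memI)
      (auto simp: algebra_D_def subfield_algebra_def star_D_eq star bij_betw_def inj_on_def
        image_image)
qed (simp add: algebra_D_def subfield_algebra_def)

lemma nonassoc_centre_A:
  assumes "K \<subseteq> L'" "K = {a. \<sigma> a = a}"
  shows "nonassoc_centre A = (\<lambda>c. [:c:]) ` K"
proof (intro equalityI subsetI)
  fix z assume z: "z \<in> nonassoc_centre A"
  then obtain c where c: "z = [:c:]" "c \<in> L'"
    by (auto simp: nonassoc_centre_def left_nucleus_A)
  \<comment> \<open>Commuting with x already forces \<sigma>(c) = c; as \<open>degree f\<close>
    exceeds 1, both sides are their own remainders.\<close>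
  have "z \<star> [:0, 1:] = [:0, 1:] \<star> z"
    using z deg_gt_1 by (simp add: nonassoc_centre_def carrier_A mult_A)
  then have "red (smult c [:0, 1:]) = red ([:0, 1:] \<cdot> [:c:])"
    unfolding star_def twist_X c(1) twist_const_mem[OF c(2)] by simp
  moreover have "[:0, 1:] \<cdot> [:c:] = [:0, \<sigma> c:]"
    by (simp add: skew_pCons_left map_poly_pCons \<sigma>_0)
  ultimately have "[:0, c:] = [:0, \<sigma> c:]"
    using red_id[of "[:0, c:]"] red_id[of "[:0, \<sigma> c:]"] deg_gt_1 by simp
  then show "z \<in> (\<lambda>c. [:c:]) ` K" using c assms by auto
next
  fix z assume "z \<in> (\<lambda>c. [:c:]) ` K"
  then obtain c where c: "z = [:c:]" "c \<in> L'" "\<sigma> c = c" using assms by auto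
  then have pow: "(\<sigma> ^^ i) c = c" for i by (induction i) auto
  \<comment> \<open>A constant fixed by \<sigma> is central in R, so it lies in the eigenring as
    well.\<close>
  have comm: "p \<cdot> z = z \<cdot> p" for p
    by (rule poly_eqI) (simp add: c(1) coeff_skew_const pow mult.commute)
  then have fz: "f \<cdot> z \<in> Rf" by (auto simp: left_mults_def)
  have "z \<star> p = p \<star> z" for p
    unfolding star_eigen[OF fz] comm using c by (simp add: star_def twist_const_mem)
  then show "z \<in> nonassoc_centre A"
    using c fz f_deg
    by (auto simp: nonassoc_centre_def left_nucleus_A middle_nucleus_A right_nucleus_A mult_A)
qed

end

section \<open>Cyclic Galois extensions\<close>

context skew_poly
begin

lemma map_poly_mult_\<sigma>: "map_poly \<sigma> (p * q) = map_poly \<sigma> p * map_poly \<sigma> q"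
  by (rule poly_eqI) (simp add: coeff_map_poly coeff_mult \<sigma>_0 \<sigma>_sum \<sigma>_mult)

lemma \<sigma>_uminus: "\<sigma> (- a) = - \<sigma> a"
  using \<sigma>_add[of a "- a"] by (simp add: \<sigma>_0 eq_neg_iff_add_eq_0 add.commute)

lemma map_poly_prod_roots: "map_poly \<sigma> (\<Prod>c\<in>S. [:- g c, 1:]) = (\<Prod>c\<in>S. [:- \<sigma> (g c), 1:])"
  by (induction S rule: infinite_finite_induct)
    (auto simp: map_poly_mult_\<sigma> map_poly_pCons \<sigma>_0 \<sigma>_one \<sigma>_uminus simp del: mult_pCons_left)

lemma \<sigma>_prod: "\<sigma> (prod g S) = (\<Prod>c\<in>S. \<sigma> (g c))"
  by (induction S rule: infinite_finite_induct) (auto simp: \<sigma>_mult \<sigma>_one)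

end

section \<open>Conjugation over a quadratic subfield\<close>

context quadratic_subfield
begin

abbreviation D where "D \<equiv> snd_part L' \<theta>"

lemma D_eqI: "c' \<in> L' \<Longrightarrow> c'' \<in> L' \<Longrightarrow> c = c' + \<theta> * c'' \<Longrightarrow> D c = c''"
  using snd_part_eq by blast

lemma D_add: "D (a + b) = D a + D b"
proof (rule D_eqI)
  show "(a - \<theta> * D a) + (b - \<theta> * D b) \<in> L'" "D a + D b \<in> L'"
    by (intro add_mem fst_part_mem snd_part_mem)+
qed (simp add: algebra_simps)

lemma D_eq_0_iff: "D a = 0 \<longleftrightarrow> a \<in> L'"
  using fst_part_mem[of a] snd_part_of_mem[of a] by auto

lemma quadratic_equation:
  obtains p q where "p \<in> L'" "q \<in> L'" "\<theta>\<^sup>2 = p * \<theta> + q"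
  using decomposition[of "\<theta>\<^sup>2"] by (metis add.commute mult.commute)

text \<open>A Leibniz rule with error term. Multiplied by p - 2 \<theta> and added to a b, it says
  that the map a + D a (p - 2 \<theta>) is multiplicative.\<close>

lemma D_mult:
  assumes "p \<in> L'" "q \<in> L'" "\<theta>\<^sup>2 = p * \<theta> + q"
  shows "D (a * b) = D a * b + a * D b + D a * D b * (p - 2 * \<theta>)"
proof (rule D_eqI)
  define a' b' where "a' = a - \<theta> * D a" and "b' = b - \<theta> * D b"
  have mem: "a' \<in> L'" "b' \<in> L'" by (simp_all add: a'_def b'_def fst_part_mem)
  show "a' * b' + q * (D a * D b) \<in> L'"
    by (intro add_mem mult_mem mem assms snd_part_mem)
  \<comment> \<open>The two contributions \<theta> D a D b cancel against the term with -2 \<theta>,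
    so only elements of \<open>L'\<close> remain.\<close>
  have "D a * b + a * D b + D a * D b * (p - 2 * \<theta>) = D a * b' + a' * D b + D a * D b * p"
    by (simp add: a'_def b'_def algebra_simps)
  also have "\<dots> \<in> L'"
    by (intro add_mem mult_mem mem assms snd_part_mem)
  finally show "D a * b + a * D b + D a * D b * (p - 2 * \<theta>) \<in> L'" .
  have "q = \<theta> * \<theta> - p * \<theta>" using assms(3) by (simp add: power2_eq_square)
  then show "a * b = a' * b' + q * (D a * D b) + \<theta> * (D a * b + a * D b + D a * D b * (p - 2 * \<theta>))"
    unfolding a'_def b'_def by (simp only:) (simp add: algebra_simps)
qed

text \<open>With \<open>\<theta>\<^sup>2 = p \<theta> + q\<close>, the map \<open>a \<mapsto> a + D a (p - 2 \<theta>)\<close> exchanges the roots \<open>\<theta>\<close> and \<open>p - \<theta>\<close>.\<close>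

lemma conjugation:
  assumes pq: "p \<in> L'" "q \<in> L'" "\<theta>\<^sup>2 = p * \<theta> + q" and sep: "p \<noteq> 2 * \<theta>"
    and K: "K \<subseteq> L'"
  shows "\<exists>\<tau>\<in>Gal K. (\<forall>a. \<tau> a = a \<longleftrightarrow> a \<in> L') \<and> (\<forall>a. \<tau> (\<tau> a) = a)"
proof -
  define \<tau> where "\<tau> a = a + D a * (p - 2 * \<theta>)" for a
  have fixed: "\<tau> a = a \<longleftrightarrow> a \<in> L'" for a
    using sep by (auto simp: \<tau>_def D_eq_0_iff)
  have "D (D a * (p - 2 * \<theta>)) = - (D a + D a)" for a
  proof (rule D_eqI)
    show "D a * p \<in> L'" "- (D a + D a) \<in> L'"
      by (intro mult_mem uminus_mem add_mem snd_part_mem pq)+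
  qed (simp add: algebra_simps)
  then have "D (\<tau> a) = - D a" for a
    by (simp add: \<tau>_def D_add)
  then have invol: "\<tau> (\<tau> a) = a" for a
    by (simp add: \<tau>_def[of "\<tau> a"]) (simp add: \<tau>_def)
  have "\<tau> \<in> ring_iso fieldL fieldL"
  proof (rule ring_iso_memI)
    show "bij_betw \<tau> (carrier fieldL) (carrier fieldL)"
      by (rule bij_betw_byWitness[of _ \<tau>]) (auto simp: invol ring_of_type_algebra_def)
    show "\<tau> \<one>\<^bsub>fieldL\<^esub> = \<one>\<^bsub>fieldL\<^esub>"
      using one_mem fixed by (simp add: ring_of_type_algebra_def)
  qed (simp_all add: ring_of_type_algebra_def \<tau>_def D_add D_mult[OF pq] algebra_simps)
  then have "\<tau> \<in> Gal K" using K fixed by (auto simp: Gal_def)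
  with fixed invol show ?thesis by blast
qed

text \<open>The values \<open>u\<close> and \<open>v\<close> come from the even and odd parts of
  \<open>g\<close>, evaluated at the square of \<theta>; in characteristic 2 the derivative retains
  only the odd part.\<close>

lemma poly_inseparable:
  assumes "(2 :: 'a) = 0" "\<theta>\<^sup>2 \<in> L'" "\<And>i. coeff g i \<in> L'"
  shows "\<exists>u\<in>L'. \<exists>v\<in>L'. poly g \<theta> = u + \<theta> * v \<and> poly (pderiv g) \<theta> = v"
  using assms(3)
proof (induction g rule: pCons_induct)
  case 0
  show ?case using zero_mem by simp
next
  case (pCons a g)
  have "coeff g i \<in> L'" for i using pCons.prems[of "Suc i"] by simp
  with pCons.IH obtain u v where uv: "u \<in> L'" "v \<in> L'" "poly g \<theta> = u + \<theta> * v"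
    "poly (pderiv g) \<theta> = v" by blast
  have "a \<in> L'" using pCons.prems[of 0] by simp
  have "\<theta> * v + \<theta> * v = 2 * (\<theta> * v)" by (rule mult_2[symmetric])
  then have "poly (pderiv (pCons a g)) \<theta> = u"
    by (simp add: pderiv_pCons uv assms(1) add.assoc)
  moreover have "poly (pCons a g) \<theta> = (a + \<theta>\<^sup>2 * v) + \<theta> * u"
    by (simp add: uv power2_eq_square algebra_simps)
  ultimately show ?case
    using add_mem[OF \<open>a \<in> L'\<close> mult_mem[OF assms(2) uv(2)]] uv(1) by blast
qed

end

section \<open>Subfields of index two\<close>

lemma subfield_fieldL:
  assumes "subfield M (fieldL :: 'l::field ring)"
  shows "1 \<in> M" "\<And>a b. a \<in> M \<Longrightarrow> b \<in> M \<Longrightarrow> a + b \<in> M" "\<And>a b. a \<in> M \<Longrightarrow> b \<in> M \<Longrightarrow> a * b \<in> M"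
    "\<And>a. a \<in> M \<Longrightarrow> - a \<in> M" "\<And>a. a \<in> M \<Longrightarrow> inverse a \<in> M"
proof -
  interpret field "fieldL :: 'l ring" by (rule field_from_type_algebra)
  note subring = subfieldE(1)[OF assms]
  have fld: "\<one>\<^bsub>fieldL\<^esub> = (1 :: 'l)" "\<zero>\<^bsub>fieldL\<^esub> = (0 :: 'l)"
    "\<And>a b :: 'l. a \<oplus>\<^bsub>fieldL\<^esub> b = a + b" "\<And>a b :: 'l. a \<otimes>\<^bsub>fieldL\<^esub> b = a * b"
    "carrier fieldL = (UNIV :: 'l set)"
    by (simp_all add: ring_of_type_algebra_def)
  have minus: "\<ominus>\<^bsub>fieldL\<^esub> a = - a" for a :: 'l
    by (rule minus_equality) (simp_all add: fld)
  show "1 \<in> M" "\<And>a b. a \<in> M \<Longrightarrow> b \<in> M \<Longrightarrow> a + b \<in> M" "\<And>a b. a \<in> M \<Longrightarrow> b \<in> M \<Longrightarrow> a * b \<in> M"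
    "\<And>a. a \<in> M \<Longrightarrow> - a \<in> M"
    using subringE(3,5,6,7)[OF subring] by (simp_all add: fld minus)
  show "inverse a \<in> M" if "a \<in> M" for a
  proof (cases "a = 0")
    case False
    with that have "a \<in> M - {\<zero>\<^bsub>fieldL\<^esub>}" by (simp add: fld)
    from subfield_m_inv(1,2)[OF assms this] show ?thesis
      by (simp add: fld inverse_unique)
  qed (use that in simp)
qed

text \<open>The dimension yields some spanning pair \<open>v\<close>, \<open>w\<close>; Cramer's
  rule exchanges it for 1 and \<open>\<theta>\<close>.\<close>

lemma quadratic_subfield_if_index_2:
  assumes L': "subfield L' (fieldL :: 'l::field ring)" and dim: "ring.dimension fieldL 2 L' UNIV"
    and \<theta>: "\<theta> \<notin> L'"
  shows "quadratic_subfield L' \<theta>"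
proof
  interpret field "fieldL :: 'l ring" by (rule field_from_type_algebra)
  note closed = subfield_fieldL[OF L']
  show "1 \<in> L'" "\<And>a b. a \<in> L' \<Longrightarrow> b \<in> L' \<Longrightarrow> a + b \<in> L'" "\<And>a b. a \<in> L' \<Longrightarrow> b \<in> L' \<Longrightarrow> a * b \<in> L'"
    "\<And>a. a \<in> L' \<Longrightarrow> - a \<in> L'" "\<And>a. a \<in> L' \<Longrightarrow> inverse a \<in> L'"
    by (fact closed)+
  have fld: "\<zero>\<^bsub>fieldL\<^esub> = (0 :: 'l)"
    "\<And>a b :: 'l. a \<oplus>\<^bsub>fieldL\<^esub> b = a + b" "\<And>a b :: 'l. a \<otimes>\<^bsub>fieldL\<^esub> b = a * b"
    by (simp_all add: ring_of_type_algebra_def)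
  have "0 \<in> L'" using closed(2)[OF closed(1) closed(4)[OF closed(1)]] by simp
  from dim[unfolded numeral_2_eq_2] obtain v E where
    E: "dimension (Suc 0) L' E" "UNIV = line_extension L' v E"
    by (blast dest: dimension_backwards[OF L'])
  from E(1) obtain w E' where "dimension 0 L' E'" "E = line_extension L' w E'"
    by (blast dest: dimension_backwards[OF L'])
  then have E_eq: "E = line_extension L' w {0}"
    using dimension_zero[OF L'] by (simp add: fld)
  have span: "\<exists>k\<in>L'. \<exists>k'\<in>L'. c = k * v + k' * w" for c
  proof -
    have "c \<in> line_extension L' v E" unfolding E(2)[symmetric] by (rule UNIV_I)
    then obtain k u where k: "k \<in> L'" "u \<in> E" "c = k * v + u"
      unfolding line_extension_mem_iff fld by blast
    from k(2) obtain k' where "k' \<in> L'" "u = k' * w"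
      unfolding E_eq line_extension_mem_iff fld by auto
    with k show ?thesis by blast
  qed
  show "\<exists>c'\<in>L'. \<exists>c''\<in>L'. c = c' + \<theta> * c''" for c
  proof -
    obtain a b where one: "a \<in> L'" "b \<in> L'" "1 = a * v + b * w" using span by blast
    obtain a' b' where th: "a' \<in> L'" "b' \<in> L'" "\<theta> = a' * v + b' * w" using span by blast
    obtain x y where c: "x \<in> L'" "y \<in> L'" "c = x * v + y * w" using span by blast
    \<comment> \<open>The determinant of the coordinates of 1 and \<open>\<theta>\<close> with
      respect to \<open>v\<close>, \<open>w\<close>.\<close>
    define d where "d = a * b' + - (a' * b)"
    have mem: "d \<in> L'" unfolding d_def by (intro closed one th)
    have dv: "d * v = b' + - (\<theta> * b)" and dw: "d * w = a * \<theta> + - a'"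
    proof -
      have av: "a * v = 1 - b * w" and bw: "b * w = 1 - a * v" 
        using one(3) by (simp_all add: eq_diff_eq add.commute)
      have "d * v = b' * (a * v) - b * (a' * v)" by (simp add: d_def algebra_simps)
      then show "d * v = b' + - (\<theta> * b)" unfolding av th(3) by (simp add: algebra_simps)
      have "d * w = a * (b' * w) - a' * (b * w)" by (simp add: d_def algebra_simps)
      then show "d * w = a * \<theta> + - a'" unfolding bw th(3) by (simp add: algebra_simps)
    qed
    \<comment> \<open>One of \<open>a\<close>, \<open>b\<close> is nonzero because 1 is; a zero
      determinant would then make \<open>\<theta>\<close> a quotient of elements of
      \<open>L'\<close>.\<close>
    have "d \<noteq> 0"
    proof
      assume "d = 0"
      with dv dw have eq: "b' = \<theta> * b" "a' = a * \<theta>" by simp_all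
      show False
      proof (cases "b = 0")
        case True
        then have "a \<noteq> 0" using one(3) by auto
        then have "\<theta> = a' * inverse a" using eq(2) by simp
        then show False using \<theta> closed(3)[OF th(1) closed(5)[OF one(1)]] by simp
      next
        case False
        then have "\<theta> = b' * inverse b" using eq(1) by simp
        then show False using \<theta> closed(3)[OF th(2) closed(5)[OF one(2)]] by simp
      qed
    qed
    have "d * c = x * (d * v) + y * (d * w)" unfolding c(3) by (simp add: algebra_simps)
    also have "\<dots> = (x * b' + - (y * a')) + \<theta> * (y * a + - (x * b))"
      unfolding dv dw by (simp add: algebra_simps)
    finally have "inverse d * (d * c) =
        inverse d * (x * b' + - (y * a')) + \<theta> * (inverse d * (y * a + - (x * b)))"
      by (simp only: distrib_left mult.left_commute)
    then have "c = inverse d * (x * b' + - (y * a')) + \<theta> * (inverse d * (y * a + - (x * b)))"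
      using \<open>d \<noteq> 0\<close> by (simp flip: mult.assoc[of "inverse d" d c])
    moreover have "inverse d * (x * b' + - (y * a')) \<in> L'" "inverse d * (y * a + - (x * b)) \<in> L'"
      by (intro closed mem one th c)+
    ultimately show ?thesis by blast
  qed
qed (fact \<theta>)

lemma Gal_skew_poly:
  assumes "\<tau> \<in> Gal K"
  shows "skew_poly \<tau>"
proof -
  have hom: "\<tau> \<in> ring_hom fieldL fieldL" using assms by (auto simp: Gal_def ring_iso_def)
  show ?thesis
    by unfold_locales (use ring_hom_add[OF hom] ring_hom_mult[OF hom] ring_hom_one[OF hom] in
      \<open>simp_all add: ring_of_type_algebra_def\<close>)
qed

lemma Gal_bij: "\<tau> \<in> Gal K \<Longrightarrow> bij \<tau>"
  by (auto simp: Gal_def ring_iso_def ring_of_type_algebra_def)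

section \<open>The cyclic Galois group and norms\<close>

locale cyclic_extension =
  fixes K :: "'l::field set" and n :: nat and \<sigma> :: "'l \<Rightarrow> 'l"
  assumes cyclic: "cyclic_galois K n \<sigma>"
begin

lemma \<sigma>_Gal: "\<sigma> \<in> Gal K"
  and Gal_eq: "Gal K = {\<sigma> ^^ i | i. True}"
  and K_subfield: "subfield K fieldL"
  using cyclic by (auto simp: cyclic_galois_def)

sublocale skew_poly \<sigma>
  using \<sigma>_Gal by (rule Gal_skew_poly)

lemma K_eq: "K = {a. \<sigma> a = a}"
proof -
  have "(\<sigma> ^^ i) a = a" if "\<sigma> a = a" for i a
    using that by (induction i) auto
  then have "{a. \<forall>\<tau>\<in>Gal K. \<tau> a = a} = {a. \<sigma> a = a}"
    using \<sigma>_Gal by (auto simp: Gal_eq)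
  then show ?thesis using cyclic by (simp add: cyclic_galois_def)
qed

lemma inj_\<sigma>: "inj \<sigma>"
  using Gal_bij[OF \<sigma>_Gal] by (rule bij_is_inj)

lemma poly_fixed_coeffs:
  assumes "map_poly \<sigma> g = g"
  shows "coeff g i \<in> K"
  using arg_cong[OF assms, of "\<lambda>p. coeff p i"] by (simp add: K_eq coeff_map_poly \<sigma>_0)

text \<open>\<open>\<theta>\<close> is a simple root of the polynomial whose roots are its distinct conjugates.\<close>

lemma separable_polynomial:
  assumes "finite (Gal K)"
  shows "\<exists>g. (\<forall>i. coeff g i \<in> K) \<and> poly g \<theta> = 0 \<and> poly (pderiv g) \<theta> \<noteq> 0"
proof -
  define S where "S = (\<lambda>\<tau>. \<tau> \<theta>) ` Gal K"
  have fin: "finite S" using assms by (simp add: S_def)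
  have "\<sigma> ` S \<subseteq> S"
  proof
    fix y assume "y \<in> \<sigma> ` S"
    then obtain i where "y = \<sigma> ((\<sigma> ^^ i) \<theta>)" by (auto simp: S_def Gal_eq)
    then have "y = (\<sigma> ^^ Suc i) \<theta>" by simp
    then show "y \<in> S" unfolding S_def Gal_eq by blast
  qed
  \<comment> \<open>An injective self-map of a finite set permutes it, so \<sigma> fixes the
    coefficients of the product over \<open>S\<close>.\<close>
  then have \<sigma>S: "\<sigma> ` S = S"
    using fin inj_\<sigma> by (metis endo_inj_surj inj_on_subset subset_UNIV)
  have \<theta>: "\<theta> \<in> S"
  proof -
    have "\<theta> = (\<sigma> ^^ 0) \<theta>" by simp
    then show ?thesis unfolding S_def Gal_eq by blast
  qed
  define g where "g = (\<Prod>c\<in>S. [:- c, 1:])"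
  have "map_poly \<sigma> g = (\<Prod>c\<in>\<sigma> ` S. [:- c, 1:])"
    unfolding g_def using map_poly_prod_roots[of "\<lambda>c. c" S] inj_on_subset[OF inj_\<sigma>, of S]
    by (simp add: prod.reindex)
  then have "map_poly \<sigma> g = g" by (simp add: \<sigma>S g_def)
  define h where "h = (\<Prod>c\<in>S - {\<theta>}. [:- c, 1:])"
  have g: "g = [:- \<theta>, 1:] * h"
    unfolding g_def h_def using fin \<theta> by (simp add: prod.remove)
  have "poly h \<theta> \<noteq> 0" using fin by (simp add: h_def poly_prod)
  then have "poly g \<theta> = 0" "poly (pderiv g) \<theta> \<noteq> 0"
    by (simp_all add: g pderiv_mult pderiv_pCons del: mult_pCons_left)
  with poly_fixed_coeffs[OF \<open>map_poly \<sigma> g = g\<close>] show ?thesis by blast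
qed

text \<open>Conjugation over \<open>L'\<close> exists unless \<theta> is a double root of its
  quadratic, that is p = 2 \<theta>. This forces characteristic 2, where the simple root provided by
  \<open>separable_polynomial\<close> gives a contradiction.\<close>

lemma quadratic_involution:
  assumes fin: "finite (Gal K)" and L': "subfield L' fieldL" "K \<subseteq> L'" "L' \<noteq> UNIV"
    "ring.dimension fieldL 2 L' UNIV"
  obtains \<tau> where "\<tau> \<in> Gal K" "\<And>a. \<tau> a = a \<longleftrightarrow> a \<in> L'" "\<And>a. \<tau> (\<tau> a) = a"
proof -
  obtain \<theta> where "\<theta> \<notin> L'" using L'(3) by auto
  then interpret quadratic_subfield L' \<theta> by (rule quadratic_subfield_if_index_2[OF L'(1,4)])
  obtain p q where pq: "p \<in> L'" "q \<in> L'" "\<theta>\<^sup>2 = p * \<theta> + q" by (rule quadratic_equation)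
  have "p \<noteq> 2 * \<theta>"
  proof
    assume p: "p = 2 * \<theta>"
    have two: "(2 :: 'l) = 0"
    proof (rule ccontr)
      assume "(2 :: 'l) \<noteq> 0"
      then have "\<theta> = p * inverse 2" using p by simp
      moreover have "inverse 2 \<in> L'"
        using inverse_mem[OF add_mem[OF one_mem one_mem]] by simp
      ultimately show False using \<open>\<theta> \<notin> L'\<close> mult_mem[OF pq(1)] by metis
    qed
    then have "\<theta>\<^sup>2 \<in> L'" using pq p by simp
    obtain g where g: "\<forall>i. coeff g i \<in> K" "poly g \<theta> = 0" "poly (pderiv g) \<theta> \<noteq> 0"
      using separable_polynomial[OF fin] by blast
    then obtain u v where uv: "u \<in> L'" "v \<in> L'" "0 = u + \<theta> * v" "v \<noteq> 0"
      using poly_inseparable[OF two \<open>\<theta>\<^sup>2 \<in> L'\<close>, of g] L'(2) by (metis subsetD)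
    \<comment> \<open>The coordinates of 0 are unique, so \<open>v\<close> would have to vanish, but
      it is the value of the derivative at the simple root.\<close>
    then show False
      using snd_part_eq[OF uv(1,2)] snd_part_of_mem[OF zero_mem] by metis
  qed
  from conjugation[OF pq this L'(2)] that show thesis by blast
qed

text \<open>A cyclic group is commutative, so \<sigma> maps the fixed points of \<tau> to fixed
  points.\<close>

lemma \<sigma>_preserves_fixed_field:
  assumes "\<tau> \<in> Gal K" "\<And>a. \<tau> a = a \<longleftrightarrow> a \<in> M" "a \<in> M"
  shows "\<sigma> a \<in> M"
proof -
  obtain i where "\<tau> = \<sigma> ^^ i" using assms(1) by (auto simp: Gal_eq)
  then have "\<tau> (\<sigma> a) = \<sigma> (\<tau> a)" by (simp add: funpow_swap1)
  then show ?thesis using assms by metis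
qed

text \<open>
  An involution of the cyclic group is the middle power \<open>\<sigma>\<^sup>j\<close>, so the norm of an element that it
  fixes is the square of the product of its first \<open>j\<close> conjugates.
\<close>

lemma norm_is_square:
  assumes fin: "finite (Gal K)" and \<tau>: "\<tau> \<in> Gal K" "\<tau> b \<noteq> b" "\<And>a. \<tau> (\<tau> a) = a" "\<tau> \<gamma> = \<gamma>"
  shows "\<exists>k\<in>K. galois_norm K \<gamma> = k\<^sup>2"
proof -
  have cancel: "\<sigma> ^^ (j - i) = id" if "\<sigma> ^^ i = \<sigma> ^^ j" "i \<le> j" for i j
  proof
    fix x
    have "(\<sigma> ^^ i) ((\<sigma> ^^ (j - i)) x) = (\<sigma> ^^ i) x"
      using that by (metis comp_apply funpow_add le_add_diff_inverse)
    then show "(\<sigma> ^^ (j - i)) x = id x"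
      using inj_\<sigma> inj_fn[of \<sigma> i] by (simp add: inj_eq)
  qed
  have "range (\<lambda>i. \<sigma> ^^ i) = Gal K" unfolding Gal_eq by blast
  then have "\<not> inj (\<lambda>i. \<sigma> ^^ i)"
    using fin range_inj_infinite[of "\<lambda>i. \<sigma> ^^ i"] by metis
  then have "\<exists>i j. i < j \<and> \<sigma> ^^ i = \<sigma> ^^ j"
    using linorder_injI[of "\<lambda>i. \<sigma> ^^ i"] by metis
  then obtain i j where "i < j" "\<sigma> ^^ i = \<sigma> ^^ j" by blast
  then have ex: "0 < j - i \<and> \<sigma> ^^ (j - i) = id" using cancel[of i j] by simp
  \<comment> \<open>The order of \<sigma>, which exists because its powers repeat in the finite
    group.\<close>
  define N where "N = (LEAST N. 0 < N \<and> \<sigma> ^^ N = id)"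
  have N: "0 < N" "\<sigma> ^^ N = id" 
    using LeastI[of "\<lambda>N. 0 < N \<and> \<sigma> ^^ N = id", OF ex] by (simp_all only: N_def)
  have least: "N \<le> i" if "0 < i" "\<sigma> ^^ i = id" for i
    unfolding N_def using that by (intro Least_le) simp
  have mod: "\<sigma> ^^ i = \<sigma> ^^ (i mod N)" for i
  proof
    fix x show "(\<sigma> ^^ i) x = (\<sigma> ^^ (i mod N)) x"
      using N(2) funpow_mod_eq[where f = \<sigma> and n = N and x = x and m = i] by simp
  qed
  have inj: "inj_on (\<lambda>i. \<sigma> ^^ i) {..<N}"
  proof (rule linorder_inj_onI)
    fix i j assume "i < j" "i \<in> {..<N}" "j \<in> {..<N}"
    then show "\<sigma> ^^ i \<noteq> \<sigma> ^^ j" using cancel[of i j] least[of "j - i"] by fastforce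
  qed auto
  have Gal: "Gal K = (\<lambda>i. \<sigma> ^^ i) ` {..<N}"
  proof (intro equalityI subsetI)
    fix \<rho> assume "\<rho> \<in> Gal K"
    then obtain i where "\<rho> = \<sigma> ^^ i" by (auto simp: Gal_eq)
    then have "\<rho> = \<sigma> ^^ (i mod N)" using mod by metis
    then show "\<rho> \<in> (\<lambda>i. \<sigma> ^^ i) ` {..<N}" using N(1) by simp
  qed (auto simp: Gal_eq)
  obtain j where j: "j < N" "\<tau> = \<sigma> ^^ j" using \<tau>(1) by (auto simp: Gal)
  have "j \<noteq> 0" using j(2) \<tau>(2) by (cases j) auto
  have "\<sigma> ^^ (j + j) = id" using \<tau>(3) j(2) by (auto simp: funpow_add fun_eq_iff)
  then have "N \<le> j + j" using least[of "j + j"] \<open>j \<noteq> 0\<close> by simp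
  have "\<sigma> ^^ (j + j - N) = id"
    using cancel[of N "j + j"] N(2) \<open>\<sigma> ^^ (j + j) = id\<close> \<open>N \<le> j + j\<close> by simp
  \<comment> \<open>The exponent j + j - N is a period below \<open>N\<close>, hence 0.\<close>
  then have Nj: "N = j + j" using least[of "j + j - N"] \<open>N \<le> j + j\<close> j(1) by force
  define P where "P = (\<Prod>i<j. (\<sigma> ^^ i) \<gamma>)"
  have "galois_norm K \<gamma> = (\<Prod>i<j + j. (\<sigma> ^^ i) \<gamma>)"
    unfolding galois_norm_def Gal Nj[symmetric] using inj by (simp add: prod.reindex)
  also have "\<dots> = P * (\<Prod>i<j. (\<sigma> ^^ (i + j)) \<gamma>)"
  proof -
    have "(\<Prod>i<j + k. (\<sigma> ^^ i) \<gamma>) = P * (\<Prod>i<k. (\<sigma> ^^ (i + j)) \<gamma>)" for k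
      by (induction k) (simp_all add: P_def mult.assoc add.commute)
    then show ?thesis .
  qed
  also have "\<dots> = P\<^sup>2"
    using \<tau>(4) j(2) by (simp add: funpow_add P_def power2_eq_square)
  finally have norm: "galois_norm K \<gamma> = P\<^sup>2" .
  \<comment> \<open>Applying \<sigma> shifts the product by one factor: \<gamma> leaves and
    \<tau>(\<gamma>) = \<gamma> enters. Cancelling \<gamma> requires it to be nonzero.\<close>
  have "\<sigma> P = P"
  proof (cases "\<gamma> = 0")
    case True
    then have "P = 0" using \<open>j \<noteq> 0\<close> by (auto simp: P_def \<sigma>_pow_0)
    then show ?thesis by (simp add: \<sigma>_0)
  next
    case False
    have "\<gamma> * \<sigma> P = (\<Prod>i<Suc j. (\<sigma> ^^ i) \<gamma>)"
      unfolding prod.lessThan_Suc_shift by (simp add: P_def \<sigma>_prod)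
    also have "\<dots> = P * \<gamma>" using \<tau>(4) j(2) by (simp add: P_def)
    finally show ?thesis using False by simp
  qed
  then show ?thesis using norm by (auto simp: K_eq)
qed

end

section \<open>The theorem\<close>

text \<open>The annihilator of R/Rf is a two-sided ideal and, as applying it to 1 shows, contained
  in Rf; the bound generates the largest such ideal.\<close>

lemma (in skew_poly) annihilator_subset_bound:
  assumes "is_bound \<sigma> f h" "\<And>c. w \<cdot> c \<in> left_mults \<sigma> f"
  shows "w \<in> left_mults \<sigma> h"
proof -
  define I where "I = {w. \<forall>c. w \<cdot> c \<in> left_mults \<sigma> f}"
  have "ideal I (skew_ring \<sigma>)"
    by (rule idealI_skew)
      (simp_all add: I_def left_mults_0 skew_add_left left_mults_add skew_assoc left_mults_skew)
  moreover have "I \<subseteq> left_mults \<sigma> f"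
  proof
    fix v assume "v \<in> I"
    then have "v \<cdot> 1 \<in> left_mults \<sigma> f" unfolding I_def by blast
    then show "v \<in> left_mults \<sigma> f" by simp
  qed
  ultimately have "I \<subseteq> genideal (skew_ring \<sigma>) {h}"
    using assms(1) by (simp add: is_bound_def)
  also have "\<dots> \<subseteq> left_mults \<sigma> h"
    using assms(1) by (intro genideal_central_subset) (simp add: is_bound_def)
  finally show ?thesis using assms(2) by (auto simp: I_def)
qed

lemma (in skew_poly) bound_left_mult:
  assumes "is_bound \<sigma> f h"
  shows "h \<in> left_mults \<sigma> f"
proof -
  have "h \<in> genideal (skew_ring \<sigma>) {h}"
    by (rule ring.genideal_self'[OF ring_skew]) (simp add: skew_ring_def)
  then show ?thesis using assms by (auto simp: is_bound_def)
qed

text \<open>The bound is a multiple q f. For \<open>m = 1\<close> the factor q is constant, equal to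
  1 as both polynomials are monic, so \<open>f\<close> would be central.\<close>

lemma (in skew_poly) degree_bound_not_central:
  assumes bound: "is_bound \<sigma> f h" and "lead_coeff f = 1" "degree f > 0"
    and "f \<notin> ring_centre (skew_ring \<sigma>)" and deg: "degree h = m * degree f"
  shows "2 \<le> m"
proof -
  have h: "lead_coeff h = 1" "h \<in> ring_centre (skew_ring \<sigma>)"
    using bound by (simp_all add: is_bound_def)
  then have "h \<noteq> 0" by auto
  obtain q where q: "h = q \<cdot> f" using bound_left_mult[OF bound] by (auto simp: left_mults_def)
  with \<open>h \<noteq> 0\<close> have "q \<noteq> 0" "f \<noteq> 0" by auto
  from degree_skew[OF this] q deg have dq: "degree q + degree f = m * degree f" by simp
  have "m \<noteq> 0" using dq assms(3) by (cases m) auto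
  moreover have "m \<noteq> 1"
  proof
    assume "m = 1"
    then obtain c where c: "q = [:c:]" using dq by (auto elim: degree_eq_zeroE)
    then have "h = smult c f" using q by simp
    moreover from this have "c = 1" using h(1) assms(2) lead_coeff_smult[of c f] by simp
    ultimately show False using h(2) assms(4) by simp
  qed
  ultimately show ?thesis by simp
qed

theorem mainTheorem18:
  fixes K L' :: "'l::field set" and \<sigma> :: "'l \<Rightarrow> 'l" and f F :: "'l poly" and \<gamma> :: 'l
    and n t s l m :: nat
  assumes galois: "cyclic_galois K n \<sigma>"
    and n_even: "n = 2 * t"
    and L'_subfield: "subfield L' fieldL" and "K \<subseteq> L'" and "L' \<noteq> UNIV"
    and L'_index: "ring.dimension fieldL 2 L' UNIV"
    and f_monic: "lead_coeff f = 1"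
    and f_irred: "irreducible_in (skew_ring \<sigma>) f"
    and f_not_central: "f \<notin> ring_centre (skew_ring \<sigma>)"
    and F_monic: "lead_coeff F = 1"
    and F_irred: "irreducible_in (poly_ring_over K) F"
    and F_deg: "Polynomial.degree F = s"
    and F_not_y: "F \<noteq> [:0, 1:]"
    and f_bound: "is_bound \<sigma> f (subst_power n F)"
    and m_factors: "num_irreducible_factors (skew_ring \<sigma>) (subst_power n F) m"
    and l_def: "m * l = n"
    and f_deg: "Polynomial.degree f = s * l"
    and f_deg_gt_1: "s * l > 1"
    and \<gamma>_f0: "\<gamma> / Polynomial.coeff f 0 \<notin> L'"
    and \<gamma>_norm: "\<not> (\<exists>k\<in>K. galois_norm K \<gamma> = k\<^sup>2)"
  shows "let A = algebra_D \<sigma> L' \<gamma> f in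
      alg_iso K (A\<lparr>carrier := left_nucleus A\<rparr>) (subfield_algebra L') \<and>
      alg_iso K (A\<lparr>carrier := middle_nucleus A\<rparr>) (subfield_algebra L') \<and>
      alg_iso K (A\<lparr>carrier := right_nucleus A\<rparr>) (eigenring \<sigma> f) \<and>
      alg_iso K (A\<lparr>carrier := nonassoc_centre A\<rparr>) (subfield_algebra K)"
proof -
  interpret cyclic_extension K n \<sigma> by unfold_locales (rule galois)
  have fin: "finite (Gal K)"
  proof (rule ccontr)
    assume "infinite (Gal K)"
    \<comment> \<open>A product over an infinite set is 1 by convention, and 1 is a square in
      \<open>K\<close>.\<close>
    then have "galois_norm K \<gamma> = 1\<^sup>2" by (simp add: galois_norm_def)
    moreover have "1 \<in> K" by (rule subfield_fieldL(1)[OF K_subfield])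
    ultimately show False using \<gamma>_norm by blast
  qed
  obtain \<tau> where \<tau>: "\<tau> \<in> Gal K" "\<And>a. \<tau> a = a \<longleftrightarrow> a \<in> L'" "\<And>a. \<tau> (\<tau> a) = a"
    using quadratic_involution[OF fin L'_subfield \<open>K \<subseteq> L'\<close> \<open>L' \<noteq> UNIV\<close> L'_index] by blast
  have "\<gamma> \<notin> L'"
  proof
    assume "\<gamma> \<in> L'"
    obtain b where "b \<notin> L'" using \<open>L' \<noteq> UNIV\<close> by auto
    then show False
      using norm_is_square[OF fin \<tau>(1) _ \<tau>(3), of b \<gamma>] \<tau>(2)[of b] \<tau>(2)[of \<gamma>]
        \<open>\<gamma> \<in> L'\<close> \<gamma>_norm by simp
  qed
  interpret Q: quadratic_subfield L' \<gamma>
    by (rule quadratic_subfield_if_index_2[OF L'_subfield L'_index \<open>\<gamma> \<notin> L'\<close>])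
  have f_pos: "degree f > 0" "degree f > 1"
    using f_deg f_deg_gt_1 by linarith+
  \<comment> \<open>The degree is n s = m l s, that is \<open>m\<close> times
    \<open>degree f\<close>.\<close>
  have "degree (subst_power n F) = m * degree f"
    by (simp add: subst_power_def degree_pcompose degree_monom_eq F_deg f_deg l_def[symmetric])
  moreover from this have "2 \<le> m"
    by (rule degree_bound_not_central[OF f_bound f_monic f_pos(1) f_not_central])
  ultimately have deg: "2 * degree f \<le> degree (subst_power n F)" by simp
  interpret twisted_algebra \<sigma> f L' \<gamma>
  proof
    show "degree f > 0" "degree f > 1" by (fact f_pos)+
    show "\<sigma> a \<in> L'" if "a \<in> L'" for a
      using \<sigma>_preserves_fixed_field[OF \<tau>(1,2) that] .
    show "2 * degree f \<le> degree w"
      if "\<And>c. w \<cdot> c \<in> left_mults \<sigma> f" "w \<noteq> 0" for w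
      using degree_left_mults[OF annihilator_subset_bound[OF f_bound that(1)] that(2)] deg by simp
  qed (fact f_monic \<gamma>_f0)+
  show ?thesis
    unfolding Let_def
    by (intro conjI alg_iso_constants[OF subset_refl left_nucleus_A]
      alg_iso_constants[OF subset_refl middle_nucleus_A] alg_iso_right_nucleus
      alg_iso_constants[OF \<open>K \<subseteq> L'\<close> nonassoc_centre_A[OF \<open>K \<subseteq> L'\<close> K_eq]])
qed

end
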